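(* If $f\in\mathcal A^\Theta([0,T])$, then $E_f\in L^\infty\big([0,T];C^{0,\phi_\Theta}_b(\mathbb R^d;\mathbb R^d)\big)$.
   Context: Fix $T\in(0,+\infty)$, a dimension $d$, and $\kappa\in\{-1,+1\}$. For $f\in L^\infty([0,T];L^1(\mathbb R^{2d}))$ set $\rho_f(t,x)=\int_{\mathbb R^d}f(t,x,v)\,dv$ and $E_f(t,x)=\kappa\int_{\mathbb R^d}K(x-y)\rho_f(t,y)\,dy$, with $K(x)=x/|x|^d$ for $x\ne0$. Growth function: $\Theta\colon[0,+\infty)\to(0,+\infty)$ is a fixed non-decreasing function. $\phi_\Theta\colon[0,+\infty)\to[0,+\infty)$ is defined by $\phi_\Theta(0)=0$, $\phi_\Theta(r)=r|\log r|\,\Theta(|\log r|)$ for $r\in(0,e^{-d-1})$, and $\phi_\Theta(r)=e^{-d-1}(d+1)\Theta(d+1)$ for $r\ge e^{-d-1}$. Set $$C^{0,\phi_\Theta}_b(\mathbb R^d;\mathbb R^d)=\Big\{E\in L^\infty(\mathbb R^d;\mathbb R^d):\ \sup_{x\ne y}\frac{|E(x)-E(y)|}{\phi_\Theta(|x-y|)}<+\infty\Big\},$$ and $E\in L^\infty([0,T];C^{0,\phi_\Theta}_b(\mathbb R^d;\mathbb R^d))$ means that the sup norm $\|E(t,\cdot)\|_{L^\infty(\mathbb R^d;\mathbb R^d)}$ and the seminorm $\sup_{x\ne y}\frac{|E(t,x)-E(t,y)|}{\phi_\Theta(|x-y|)}$ are bounded uniformly for a.e. $t\in[0,T]$. Spaces: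 $Y^\Theta_{\mathrm{ul}}(\mathbb R^d)$ is the set of functions $g$ with $\sup_{p\in[1,\infty)}\|g\|_{L^p_{\mathrm{ul}}}/\Theta(p)<+\infty$, where $\|g\|_{L^p_{\mathrm{ul}}}=\sup_{x\in\mathbb R^d}\|g\|_{L^p(B_1(x))}$. $\mathcal A^\Theta([0,T])=\{f\in L^\infty([0,T];L^1(\mathbb R^{2d})):\rho_f\in L^\infty([0,T];Y^\Theta_{\mathrm{ul}}(\mathbb R^d))\}$. *)

theory Defs
  imports "HOL-Analysis.Analysis" "HOL-Probability.Essential_Supremum"
begin

text \<open>
  Elements of Lebesgue and Bochner spaces are represented by functions (not by classes modulo
  almost-everywhere equality); norms take values in \<^typ>\<open>ennreal\<close>. The space
  $R^d$ is an arbitrary Euclidean space \<^typ>\<open>'a::euclidean_space\<close>, so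
  $d$ is its \<open>DIM\<close>, and $R^{2d}$ is \<^typ>\<open>'a::euclidean_space \<times> 'a\<close>.
\<close>

text \<open>
  \<open>Linf_time T X N\<close> is $L^\infty([0,T];X)$ for a function space \<open>X\<close> with norm \<open>N\<close>.
  Measurability is joint Lebesgue measurability in time and space. For \<open>X = L1\<close> this is
  Bochner measurability; the other spaces used below are not separable.
\<close>

definition Linf_time ::
  "real \<Rightarrow> ('b::euclidean_space \<Rightarrow> 'c::euclidean_space) set \<Rightarrow> (('b \<Rightarrow> 'c) \<Rightarrow> ennreal)
    \<Rightarrow> (real \<Rightarrow> 'b \<Rightarrow> 'c) set" where
  "Linf_time T X N = {u.
     (\<lambda>(t, x). u t x) \<in> borel_measurable (lebesgue_on ({0..T} \<times> UNIV)) \<and>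
     (AE t in lebesgue_on {0..T}. u t \<in> X) \<and>
     (\<exists>C::real. AE t in lebesgue_on {0..T}. N (u t) \<le> ennreal C)}"

definition L1_norm :: "('b::euclidean_space \<Rightarrow> 'c::euclidean_space) \<Rightarrow> ennreal" where
  "L1_norm g = (\<integral>\<^sup>+x. ennreal (norm (g x)) \<partial>lebesgue)"

definition L1 :: "('b::euclidean_space \<Rightarrow> 'c::euclidean_space) set" where
  "L1 = {g. integrable lebesgue g}"

definition Lp_norm_on :: "'b::euclidean_space set \<Rightarrow> real \<Rightarrow> ('b \<Rightarrow> real) \<Rightarrow> ennreal" where
  "Lp_norm_on A p g =
     (let I = (\<integral>\<^sup>+x\<in>A. ennreal (\<bar>g x\<bar> powr p) \<partial>lebesgue)
      in if I = \<infinity> then \<infinity> else ennreal (enn2real I powr (1 / p)))"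

definition Lp_ul_norm :: "real \<Rightarrow> ('b::euclidean_space \<Rightarrow> real) \<Rightarrow> ennreal" where
  "Lp_ul_norm p g = (SUP x. Lp_norm_on (ball x 1) p g)"

definition Y_ul_norm :: "(real \<Rightarrow> real) \<Rightarrow> ('b::euclidean_space \<Rightarrow> real) \<Rightarrow> ennreal" where
  "Y_ul_norm \<Theta> g = (SUP p\<in>{1..}. Lp_ul_norm p g / ennreal (\<Theta> p))"

definition Y_ul :: "(real \<Rightarrow> real) \<Rightarrow> ('b::euclidean_space \<Rightarrow> real) set" where
  "Y_ul \<Theta> = {g \<in> borel_measurable lebesgue. Y_ul_norm \<Theta> g < \<infinity>}"

definition growth_function :: "(real \<Rightarrow> real) \<Rightarrow> bool" where
  "growth_function \<Theta> \<longleftrightarrow> (\<forall>r\<ge>0. \<Theta> r > 0) \<and> mono_on {0..} \<Theta>"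

text \<open>The first argument is the dimension. Only arguments \<open>r \<ge> 0\<close> are meaningful.\<close>

definition phi :: "nat \<Rightarrow> (real \<Rightarrow> real) \<Rightarrow> real \<Rightarrow> real" where
  "phi d \<Theta> r =
     (if r = 0 then 0
      else if r < exp (- real d - 1) then r * \<bar>ln r\<bar> * \<Theta> \<bar>ln r\<bar>
      else exp (- real d - 1) * (real d + 1) * \<Theta> (real d + 1))"

definition Linf_norm :: "('b::euclidean_space \<Rightarrow> 'c::euclidean_space) \<Rightarrow> ennreal" where
  "Linf_norm E = esssup lebesgue (\<lambda>x. ennreal (norm (E x)))"

definition modulus_seminorm ::
  "(real \<Rightarrow> real) \<Rightarrow> ('b::euclidean_space \<Rightarrow> 'c::euclidean_space) \<Rightarrow> ennreal" where
  "modulus_seminorm \<phi> E =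
     (SUP (x, y)\<in>{(x, y). x \<noteq> y}. ennreal (norm (E x - E y) / \<phi> (norm (x - y))))"

definition Cb_norm ::
  "(real \<Rightarrow> real) \<Rightarrow> ('b::euclidean_space \<Rightarrow> 'c::euclidean_space) \<Rightarrow> ennreal" where
  "Cb_norm \<phi> E = Linf_norm E + modulus_seminorm \<phi> E"

definition Cb ::
  "(real \<Rightarrow> real) \<Rightarrow> ('b::euclidean_space \<Rightarrow> 'c::euclidean_space) set" where
  "Cb \<phi> = {E \<in> borel_measurable lebesgue. Linf_norm E < \<infinity> \<and> modulus_seminorm \<phi> E < \<infinity>}"

definition density_of ::
  "(real \<Rightarrow> 'a::euclidean_space \<times> 'a \<Rightarrow> real) \<Rightarrow> real \<Rightarrow> 'a \<Rightarrow> real" where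
  "density_of f t x = (\<integral>v. f t (x, v) \<partial>lebesgue)"

definition kernel :: "'a::euclidean_space \<Rightarrow> 'a" where
  "kernel x = x /\<^sub>R norm x ^ DIM('a)"

definition field_integrand ::
  "(real \<Rightarrow> 'a::euclidean_space \<times> 'a \<Rightarrow> real) \<Rightarrow> real \<Rightarrow> 'a \<Rightarrow> 'a \<Rightarrow> 'a" where
  "field_integrand f t x y = density_of f t y *\<^sub>R kernel (x - y)"

definition field_of ::
  "real \<Rightarrow> (real \<Rightarrow> 'a::euclidean_space \<times> 'a \<Rightarrow> real) \<Rightarrow> real \<Rightarrow> 'a \<Rightarrow> 'a" where
  "field_of \<kappa> f t x = \<kappa> *\<^sub>R (\<integral>y. field_integrand f t x y \<partial>lebesgue)"

definition A_space ::
  "(real \<Rightarrow> real) \<Rightarrow> real \<Rightarrow> (real \<Rightarrow> 'a::euclidean_space \<times> 'a \<Rightarrow> real) set" where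
  "A_space \<Theta> T =
     {f \<in> Linf_time T L1 L1_norm. density_of f \<in> Linf_time T (Y_ul \<Theta>) (Y_ul_norm \<Theta>)}"

text \<open>
  The Bochner integral of a non-integrable function is 0 by convention, so membership of
  \<^term>\<open>field_of \<kappa> f\<close> in a function space does not by itself say that the defining
  integral converges. The next predicate says so: for almost every time it converges
  absolutely at every point.
\<close>

definition field_well_defined ::
  "real \<Rightarrow> (real \<Rightarrow> 'a::euclidean_space \<times> 'a \<Rightarrow> real) \<Rightarrow> bool" where
  "field_well_defined T f \<longleftrightarrow>
     (AE t in lebesgue_on {0..T}. \<forall>x. integrable lebesgue (field_integrand f t x))"

end

theory Submission
  imports Defs
begin

text \<open>
  Write \<open>d\<close> for the dimension and \<open>r = |x - y|\<close>. Hoelder's inequality bounds the mass of the density in a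
  ball of radius \<open>s \<le> 1\<close> by a constant times \<open>\<Theta>(p) s\<^bsup>d - d/p\<^esup>\<close>, and integrating against this bound by layers
  controls the integrals of the density against powers of \<open>|x - z|\<close>. For small \<open>r\<close> the difference of the
  two fields splits into the range \<open>|x - z| < 2r\<close>, where each kernel is estimated separately, and the rest,
  where the mean value bound for the kernel gains a factor \<open>r\<close>. The choice \<open>p = |log r|\<close> makes
  \<open>r\<^bsup>-d/p\<^esup>\<close> equal to the constant \<open>e\<^bsup>d\<^esup>\<close>, so that every range contributes at most \<open>r |log r| \<Theta>(|log r|)\<close>.
  Large \<open>r\<close> reduces to boundedness of the field.
\<close>

subsection \<open>The kernel\<close>

text \<open>Lets \<open>measurable\<close> handle indicators of balls whose radius varies; the
  Tonelli step in \<open>nn_integral_radial_le\<close> needs them jointly measurable in point and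
  radius.\<close>

lemma pred_mem_ball [measurable (raw)]:
  fixes f g :: "'b \<Rightarrow> 'a::euclidean_space"
  assumes [measurable]: "f \<in> borel_measurable M" "g \<in> borel_measurable M" "r \<in> borel_measurable M"
  shows "Measurable.pred M (\<lambda>z. f z \<in> ball (g z) (r z))"
  unfolding mem_ball by measurable

text \<open>The mean value bound for powers, obtained by telescoping. For \<open>n = 0\<close> the
  truncated exponent \<open>n - 1\<close> is harmless, as the factor \<open>real n\<close>
  vanishes.\<close>

lemma abs_power_diff_le:
  fixes u v m :: real
  assumes "0 \<le> u" "u \<le> m" "0 \<le> v" "v \<le> m"
  shows "\<bar>u ^ n - v ^ n\<bar> \<le> real n * m ^ (n - 1) * \<bar>u - v\<bar>"
proof (induction n)
  case (Suc n)
  have "u ^ Suc n - v ^ Suc n = u * (u ^ n - v ^ n) + (u - v) * v ^ n"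
    by (simp add: algebra_simps)
  then have "\<bar>u ^ Suc n - v ^ Suc n\<bar> \<le> \<bar>u\<bar> * \<bar>u ^ n - v ^ n\<bar> + \<bar>u - v\<bar> * \<bar>v ^ n\<bar>"
    by (metis abs_mult abs_triangle_ineq)
  also have "\<dots> \<le> m * (real n * m ^ (n - 1) * \<bar>u - v\<bar>) + \<bar>u - v\<bar> * m ^ n"
    using assms Suc by (intro add_mono mult_mono) (auto simp: power_mono)
  also have "\<dots> = real (Suc n) * m ^ (Suc n - 1) * \<bar>u - v\<bar>"
    by (cases n) (simp_all add: algebra_simps)
  finally show ?case .
qed simp

text \<open>At the origin both sides are zero, even in dimension one, because
  \<open>0 powr 0 = 0\<close>.\<close>

lemma norm_kernel: "norm (kernel x) = norm x powr (1 - real DIM('a))"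
  for x :: "'a::euclidean_space"
  by (cases "x = 0") (simp_all add: kernel_def powr_diff powr_realpow divide_inverse_commute)

lemma borel_measurable_kernel [measurable]: "kernel \<in> borel_measurable borel"
  unfolding kernel_def by measurable

text \<open>The mean value bound without derivatives: the difference splits into a change of the
  numerator and a change of the denominator. The first hypothesis keeps \<open>norm b\<close>
  between 1/2 and 3/2 of \<open>norm a\<close>; the ratio of these two factors is the 3 in the
  constant.\<close>

lemma norm_kernel_diff_le:
  fixes a b :: "'a::euclidean_space"
  assumes "2 * norm (a - b) \<le> norm a" "a \<noteq> 0"
  shows "norm (kernel a - kernel b)
    \<le> (1 + real DIM('a) * 3 ^ (DIM('a) - 1)) * norm (a - b) * norm a powr (- real DIM('a))"
proof -
  define d where "d = DIM('a)"
  define \<alpha> \<beta> r where "\<alpha> = norm a" and "\<beta> = norm b" and "r = norm (a - b)"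
  have d: "d = Suc (d - 1)"
    using DIM_positive[where 'a='a] by (simp add: d_def)
  have \<alpha>: "\<alpha> > 0" using assms by (simp add: \<alpha>_def)
  have diff: "\<bar>\<alpha> - \<beta>\<bar> \<le> r"
    unfolding \<alpha>_def \<beta>_def r_def by (rule norm_triangle_ineq3)
  have r: "2 * r \<le> \<alpha>" using assms by (simp add: \<alpha>_def r_def)
  have \<beta>: "\<alpha> / 2 \<le> \<beta>" "\<beta> \<le> 3 / 2 * \<alpha>" using diff r by linarith+
  then have \<beta>0: "\<beta> > 0" using \<alpha> by linarith
  have eq: "kernel a - kernel b
      = (a - b) /\<^sub>R \<alpha> ^ d + ((\<beta> ^ d - \<alpha> ^ d) / (\<alpha> ^ d * \<beta> ^ d)) *\<^sub>R b"
  proof -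
    have "inverse (\<alpha> ^ d) = inverse (\<beta> ^ d) + (\<beta> ^ d - \<alpha> ^ d) / (\<alpha> ^ d * \<beta> ^ d)"
      using \<alpha> \<beta>0 by (simp add: field_simps)
    then have "inverse (\<alpha> ^ d) *\<^sub>R b
        = inverse (\<beta> ^ d) *\<^sub>R b + ((\<beta> ^ d - \<alpha> ^ d) / (\<alpha> ^ d * \<beta> ^ d)) *\<^sub>R b"
      by (metis scaleR_left_distrib)
    then show ?thesis
      unfolding kernel_def \<alpha>_def[symmetric] \<beta>_def[symmetric] d_def[symmetric]
      by (simp add: scaleR_diff_right)
  qed
  have "norm (((\<beta> ^ d - \<alpha> ^ d) / (\<alpha> ^ d * \<beta> ^ d)) *\<^sub>R b)
      = \<bar>\<beta> ^ d - \<alpha> ^ d\<bar> * \<beta> / (\<alpha> ^ d * \<beta> ^ d)"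
    using \<alpha> \<beta>0 by (simp add: \<beta>_def abs_mult)
  \<comment> \<open>The norm of \<open>b\<close> cancels one of the \<open>d\<close> factors of
    \<open>\<beta> ^ d\<close>.\<close>
  also have "\<dots> = \<bar>\<beta> ^ d - \<alpha> ^ d\<bar> / (\<alpha> ^ d * \<beta> ^ (d - 1))"
    using \<beta>0 by (subst (3) d) simp
  also have "\<dots> \<le> (real d * (3 / 2 * \<alpha>) ^ (d - 1) * r) / (\<alpha> ^ d * (\<alpha> / 2) ^ (d - 1))"
  proof (intro frac_le mult_mono power_mono)
    have "\<bar>\<beta> ^ d - \<alpha> ^ d\<bar> \<le> real d * (3 / 2 * \<alpha>) ^ (d - 1) * \<bar>\<beta> - \<alpha>\<bar>"
      using \<alpha> \<beta>0 \<beta> by (intro abs_power_diff_le) auto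
    also have "\<dots> \<le> real d * (3 / 2 * \<alpha>) ^ (d - 1) * r"
      using diff \<alpha> by (intro mult_left_mono) auto
    finally show "\<bar>\<beta> ^ d - \<alpha> ^ d\<bar> \<le> real d * (3 / 2 * \<alpha>) ^ (d - 1) * r" .
  qed (use \<alpha> \<beta> \<beta>0 in \<open>auto simp: r_def\<close>)
  also have "\<dots> = real d * 3 ^ (d - 1) * r / \<alpha> ^ d"
    using \<alpha> by (simp add: power_mult_distrib power_divide field_simps)
  finally have "norm (((\<beta> ^ d - \<alpha> ^ d) / (\<alpha> ^ d * \<beta> ^ d)) *\<^sub>R b) \<le> real d * 3 ^ (d - 1) * r / \<alpha> ^ d" .
  moreover have "norm ((a - b) /\<^sub>R \<alpha> ^ d) = r / \<alpha> ^ d"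
    using \<alpha> by (simp add: r_def divide_inverse_commute)
  ultimately have "norm (kernel a - kernel b) \<le> r / \<alpha> ^ d + real d * 3 ^ (d - 1) * r / \<alpha> ^ d"
    unfolding eq by (metis add_left_mono norm_triangle_ineq order_trans)
  also have "\<dots> = (1 + real d * 3 ^ (d - 1)) * r * \<alpha> powr (- real d)"
    using \<alpha> by (simp add: powr_minus powr_realpow field_simps)
  finally show ?thesis unfolding d_def \<alpha>_def r_def .
qed

section \<open>Hoelder's inequality on a set of finite measure\<close>

text \<open>A version of Hoelder's inequality with an extra factor 2, by truncation: a value above a
  level \<open>l\<close> is at most \<open>l powr (1 - p)\<close> times its \<open>p\<close>-th
  power.\<close>

lemma nn_integral_abs_le_powr:
  fixes h :: "'b \<Rightarrow> real"
  assumes [measurable]: "h \<in> borel_measurable M" "B \<in> sets M"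
    and V: "emeasure M B = ennreal V" "V > 0" and p: "p \<ge> 1" and N: "N > 0"
    and I: "(\<integral>\<^sup>+x\<in>B. ennreal (\<bar>h x\<bar> powr p) \<partial>M) \<le> ennreal (N powr p)"
  shows "(\<integral>\<^sup>+x\<in>B. ennreal \<bar>h x\<bar> \<partial>M) \<le> ennreal (2 * N * V powr (1 - 1 / p))"
proof -
  \<comment> \<open>This level balances the two terms: each contributes
    \<open>N * V powr (1 - 1 / p)\<close>.\<close>
  define l where "l = N * V powr (- 1 / p)"
  have l: "l > 0" using V N by (simp add: l_def)
  have pw: "y \<le> l + l powr (1 - p) * y powr p" if "y \<ge> 0" for y
  proof (cases "y \<le> l")
    case False
    then have y: "y > l" "y > 0" using l by auto
    have "1 \<le> (y / l) powr (p - 1)" using y l p by (intro ge_one_powr_ge_zero) auto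
    then have "y \<le> y * (y / l) powr (p - 1)" using y by simp
    also have "\<dots> = y powr p * l powr (1 - p)"
      using y l by (simp add: powr_divide powr_diff powr_mult_base field_simps)
    finally show ?thesis using l by (simp add: mult.commute)
  qed (simp add: add_increasing2)
  have "(\<integral>\<^sup>+x\<in>B. ennreal \<bar>h x\<bar> \<partial>M)
      \<le> (\<integral>\<^sup>+x. (ennreal l * indicator B x
          + ennreal (l powr (1 - p)) * (ennreal (\<bar>h x\<bar> powr p) * indicator B x)) \<partial>M)"
    using pw[OF abs_ge_zero] l
    by (intro nn_integral_mono)
       (auto simp: indicator_def simp flip: ennreal_mult ennreal_plus intro!: ennreal_leI)
  also have "\<dots> = ennreal l * emeasure M B
      + ennreal (l powr (1 - p)) * (\<integral>\<^sup>+x\<in>B. ennreal (\<bar>h x\<bar> powr p) \<partial>M)"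
    by (simp add: nn_integral_add nn_integral_cmult)
  also have "\<dots> \<le> ennreal l * ennreal V + ennreal (l powr (1 - p)) * ennreal (N powr p)"
    using I V by (intro add_mono mult_left_mono) auto
  also have "\<dots> = ennreal (l * V + l powr (1 - p) * N powr p)"
    using l V by (simp add: ennreal_mult ennreal_plus)
  also have "l * V = N * V powr (1 - 1 / p)"
    using V by (simp add: l_def powr_diff powr_minus_divide)
  also have "l powr (1 - p) * N powr p = N * V powr (1 - 1 / p)"
  proof -
    have "l powr (1 - p) = N powr (1 - p) * V powr ((- 1 / p) * (1 - p))"
      using N V by (simp add: l_def powr_mult powr_powr)
    also have "(- 1 / p) * (1 - p) = 1 - 1 / p" using p by (simp add: field_simps)
    finally show ?thesis using N by (simp add: powr_diff)
  qed
  finally show ?thesis by (simp add: mult.assoc)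
qed

subsection \<open>Radial integrals\<close>

text \<open>The antiderivative is \<open>s powr e / e\<close>. A negative \<open>e\<close> is
  allowed away from the origin, while \<open>l = 0\<close> requires \<open>e > 0\<close> for
  convergence.\<close>

lemma nn_integral_powr:
  fixes l u e c :: real
  assumes "0 \<le> l" "l \<le> u" "e \<noteq> 0" "l = 0 \<Longrightarrow> e > 0" "c \<ge> 0"
  shows "(\<integral>\<^sup>+s\<in>{l..u}. ennreal (c * s powr (e - 1)) \<partial>lborel)
    = ennreal (c * ((u powr e - l powr e) / e))"
proof -
  have "((\<lambda>s. s powr (e - 1)) has_integral (u powr e - l powr e) / e) {l..u}"
  proof (cases "l = 0")
    case True
    then show ?thesis using has_integral_powr_from_0[of "e - 1" u] assms by simp
  next
    case False
    have "((\<lambda>s. s powr (e - 1)) has_integral u powr e / e - l powr e / e) {l..u}"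
      using False assms
      by (intro fundamental_theorem_of_calculus)
         (auto intro!: derivative_eq_intros simp flip: has_real_derivative_iff_has_vector_derivative)
    then show ?thesis by (simp add: diff_divide_distrib)
  qed
  from has_integral_mult_right[OF this, of c]
  have *: "((\<lambda>s. c * s powr (e - 1)) has_integral c * ((u powr e - l powr e) / e)) {l..u}" .
  have "(\<integral>\<^sup>+s\<in>{l..u}. ennreal (c * s powr (e - 1)) \<partial>lborel)
      = integral\<^sup>N lborel (\<lambda>s. ennreal (indicator {l..u} s * (c * s powr (e - 1))))"
    by (intro nn_integral_cong) (auto simp: indicator_def)
  also have "\<dots> = ennreal (c * ((u powr e - l powr e) / e))"
    using * assms by (intro nn_integral_has_integral_lebesgue) auto
  finally show ?thesis .
qed

text \<open>
  Layer cake: \<open>a * s powr (- a - 1)\<close> is integrated over \<open>s\<close> from \<open>dist x z\<close> to \<open>R\<close>, and Tonelli's theorem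
  turns the integral over \<open>z\<close> into the masses of the balls of radius \<open>s\<close>.
\<close>

lemma nn_integral_radial_le:
  fixes h :: "'a::euclidean_space \<Rightarrow> ennreal"
  assumes [measurable]: "h \<in> borel_measurable borel"
    and a: "0 \<le> a" and q: "0 \<le> q" "q < R"
  shows "(\<integral>\<^sup>+z\<in>{z. q \<le> dist x z \<and> dist x z < R}. (h z * ennreal (dist x z powr - a)) \<partial>lborel)
    \<le> ennreal (R powr - a) * (\<integral>\<^sup>+z\<in>ball x R. h z \<partial>lborel)
      + (\<integral>\<^sup>+s\<in>{q..R}. (ennreal (a * s powr (- a - 1)) * (\<integral>\<^sup>+z\<in>ball x s. h z \<partial>lborel)) \<partial>lborel)"
proof -
  have pw: "h z * ennreal (dist x z powr - a) * indicator {z. q \<le> dist x z \<and> dist x z < R} z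
      \<le> ennreal (R powr - a) * (h z * indicator (ball x R) z)
        + (\<integral>\<^sup>+s. ennreal (a * s powr (- a - 1)) * indicator {q..R} s
                * (h z * indicator (ball x s) z) \<partial>lborel)" for z
  \<comment> \<open>In the remaining cases the bound is immediate: at \<open>z = x\<close> the power
    of the distance is zero by convention, and for \<open>a = 0\<close> the first term on the right
    already dominates.\<close>
  proof (cases "q \<le> dist x z \<and> dist x z < R \<and> x \<noteq> z \<and> a \<noteq> 0")
    case True
    define r where "r = dist x z"
    have r: "0 < r" "q \<le> r" "r < R" using True by (auto simp: r_def)
    have "ennreal (r powr - a) = ennreal (R powr - a) + ennreal (a * ((R powr - a - r powr - a) / - a))"
    proof -
      have "R powr - a \<le> r powr - a" using a r by (intro powr_mono2') auto
      moreover have "a * ((R powr - a - r powr - a) / - a) = r powr - a - R powr - a"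
        using True by simp
      ultimately show ?thesis by (simp flip: ennreal_plus)
    qed
    also have "ennreal (a * ((R powr - a - r powr - a) / - a))
        = (\<integral>\<^sup>+s\<in>{r..R}. ennreal (a * s powr (- a - 1)) \<partial>lborel)"
      using a r True by (intro nn_integral_powr[symmetric]) auto
    \<comment> \<open>The endpoint is removed because \<open>z\<close> lies in the open ball
      \<open>ball x s\<close> only when \<open>s > r\<close>.\<close>
    also have "\<dots> = (\<integral>\<^sup>+s\<in>{r<..R}. ennreal (a * s powr (- a - 1)) \<partial>lborel)"
      by (intro nn_integral_cong_AE) (use AE_lborel_singleton[of r] in \<open>auto simp: indicator_def\<close>)
    finally have "ennreal (r powr - a) * h z = ennreal (R powr - a) * h z
        + (\<integral>\<^sup>+s. ennreal (a * s powr (- a - 1)) * indicator {r<..R} s * h z \<partial>lborel)"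
      by (subst nn_integral_multc) (simp_all only: distrib_right, measurable)
    moreover have "(\<integral>\<^sup>+s. ennreal (a * s powr (- a - 1)) * indicator {r<..R} s * h z \<partial>lborel)
        \<le> (\<integral>\<^sup>+s. ennreal (a * s powr (- a - 1)) * indicator {q..R} s
                * (h z * indicator (ball x s) z) \<partial>lborel)"
      using r by (intro nn_integral_mono) (auto simp: indicator_def r_def)
    ultimately have "ennreal (r powr - a) * h z \<le> ennreal (R powr - a) * h z
        + (\<integral>\<^sup>+s. ennreal (a * s powr (- a - 1)) * indicator {q..R} s
                * (h z * indicator (ball x s) z) \<partial>lborel)"
      by (simp only: add_left_mono)
    moreover have "h z * ennreal (dist x z powr - a) * indicator {z. q \<le> dist x z \<and> dist x z < R} z
        = ennreal (r powr - a) * h z"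
      using True by (simp add: r_def mult.commute)
    moreover have "h z * indicator (ball x R) z = h z" using True by simp
    ultimately show ?thesis by (simp only:)
  next
    case False
    then show ?thesis by (cases "a = 0") (auto simp: indicator_def)
  qed
  have m: "(\<lambda>(z, s). ennreal (a * s powr (- a - 1)) * indicator {q..R} s
                * (h z * indicator (ball x s) z)) \<in> borel_measurable (lborel \<Otimes>\<^sub>M lborel)"
    by measurable
  have "(\<integral>\<^sup>+z\<in>{z. q \<le> dist x z \<and> dist x z < R}. (h z * ennreal (dist x z powr - a)) \<partial>lborel)
      \<le> (\<integral>\<^sup>+z. (ennreal (R powr - a) * (h z * indicator (ball x R) z)
        + (\<integral>\<^sup>+s. ennreal (a * s powr (- a - 1)) * indicator {q..R} s
                * (h z * indicator (ball x s) z) \<partial>lborel)) \<partial>lborel)"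
    by (intro nn_integral_mono pw)
  also have "\<dots> = (\<integral>\<^sup>+z. (ennreal (R powr - a) * (h z * indicator (ball x R) z)) \<partial>lborel)
      + (\<integral>\<^sup>+z. (\<integral>\<^sup>+s. ennreal (a * s powr (- a - 1)) * indicator {q..R} s
                * (h z * indicator (ball x s) z) \<partial>lborel) \<partial>lborel)"
  proof (rule nn_integral_add)
    show "(\<lambda>z. \<integral>\<^sup>+s. ennreal (a * s powr (- a - 1)) * indicator {q..R} s
                * (h z * indicator (ball x s) z) \<partial>lborel) \<in> borel_measurable lborel"
      using lborel.borel_measurable_nn_integral_fst[OF m] by (simp only: prod.case)
  qed measurable
  also have "(\<integral>\<^sup>+z. (ennreal (R powr - a) * (h z * indicator (ball x R) z)) \<partial>lborel)
      = ennreal (R powr - a) * (\<integral>\<^sup>+z\<in>ball x R. h z \<partial>lborel)"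
    by (rule nn_integral_cmult) measurable
  also have "(\<integral>\<^sup>+z. (\<integral>\<^sup>+s. ennreal (a * s powr (- a - 1)) * indicator {q..R} s
                * (h z * indicator (ball x s) z) \<partial>lborel) \<partial>lborel)
      = (\<integral>\<^sup>+s. (\<integral>\<^sup>+z. ennreal (a * s powr (- a - 1)) * indicator {q..R} s
                * (h z * indicator (ball x s) z) \<partial>lborel) \<partial>lborel)"
    using m by (rule lborel_pair.Fubini'[symmetric])
  also have "\<dots> = (\<integral>\<^sup>+s\<in>{q..R}. (ennreal (a * s powr (- a - 1)) * (\<integral>\<^sup>+z\<in>ball x s. h z \<partial>lborel)) \<partial>lborel)"
    by (intro nn_integral_cong, subst nn_integral_cmult) (measurable, simp only: mult.assoc mult.commute[of "indicator {q..R} _"])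
  finally show ?thesis .
qed

text \<open>A power bound on the masses turns the layer integral into a multiple of the integral of
  \<open>s powr (b - a - 1)\<close>. The condition \<open>a \<noteq> b\<close> excludes a logarithm,
  and \<open>a < b\<close> gives convergence when the range reaches the origin.\<close>

lemma nn_integral_radial_powr_le:
  fixes h :: "'a::euclidean_space \<Rightarrow> ennreal"
  assumes h: "h \<in> borel_measurable borel"
    and a: "0 \<le> a" and q: "0 \<le> q" "q < R" and c: "c \<ge> 0"
    and ab: "a \<noteq> b" "q = 0 \<Longrightarrow> a < b"
    and mass: "\<And>s. 0 < s \<Longrightarrow> s \<le> R \<Longrightarrow> (\<integral>\<^sup>+z\<in>ball x s. h z \<partial>lborel) \<le> ennreal (c * s powr b)"
  shows "(\<integral>\<^sup>+z\<in>{z. q \<le> dist x z \<and> dist x z < R}. (h z * ennreal (dist x z powr - a)) \<partial>lborel)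
    \<le> ennreal (c * (R powr (b - a) + a * ((R powr (b - a) - q powr (b - a)) / (b - a))))"
proof -
  have R: "R > 0" using q by simp
  have "ennreal (R powr - a) * (\<integral>\<^sup>+z\<in>ball x R. h z \<partial>lborel)
      \<le> ennreal (R powr - a) * ennreal (c * R powr b)"
    using R by (intro mult_left_mono mass) auto
  also have "\<dots> = ennreal (c * R powr (b - a))"
    using R c by (simp add: powr_diff powr_minus_divide flip: ennreal_mult)
  finally have 1: "ennreal (R powr - a) * (\<integral>\<^sup>+z\<in>ball x R. h z \<partial>lborel) \<le> ennreal (c * R powr (b - a))" .
  have "(\<integral>\<^sup>+s\<in>{q..R}. (ennreal (a * s powr (- a - 1)) * (\<integral>\<^sup>+z\<in>ball x s. h z \<partial>lborel)) \<partial>lborel)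
      \<le> (\<integral>\<^sup>+s\<in>{q..R}. ennreal (a * c * s powr (b - a - 1)) \<partial>lborel)"
  proof (intro nn_integral_mono)
    fix s :: real
    have "ennreal (a * s powr (- a - 1)) * (\<integral>\<^sup>+z\<in>ball x s. h z \<partial>lborel)
        \<le> ennreal (a * c * s powr (b - a - 1))" if "q \<le> s" "s \<le> R"
    \<comment> \<open>The mass bound is assumed for positive radii only; at \<open>s = 0\<close> the
      factor \<open>s powr (- a - 1)\<close> is zero by convention.\<close>
    proof (cases "s = 0")
      case False
      then have s: "s > 0" using that q by simp
      have "ennreal (a * s powr (- a - 1)) * (\<integral>\<^sup>+z\<in>ball x s. h z \<partial>lborel)
          \<le> ennreal (a * s powr (- a - 1)) * ennreal (c * s powr b)"
        using s that by (intro mult_left_mono mass) auto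
      also have "\<dots> = ennreal (a * c * s powr (b - a - 1))"
        using s a c by (simp add: powr_diff powr_minus_divide mult_ac flip: ennreal_mult)
      finally show ?thesis .
    qed simp
    then show "ennreal (a * s powr (- a - 1)) * (\<integral>\<^sup>+z\<in>ball x s. h z \<partial>lborel) * indicator {q..R} s
        \<le> ennreal (a * c * s powr (b - a - 1)) * indicator {q..R} s"
      by (simp add: indicator_def)
  qed
  also have "\<dots> = ennreal (a * c * ((R powr (b - a) - q powr (b - a)) / (b - a)))"
    using q a c ab by (intro nn_integral_powr) auto
  finally have 2: "(\<integral>\<^sup>+s\<in>{q..R}. (ennreal (a * s powr (- a - 1)) * (\<integral>\<^sup>+z\<in>ball x s. h z \<partial>lborel)) \<partial>lborel)
      \<le> ennreal (a * c * ((R powr (b - a) - q powr (b - a)) / (b - a)))" .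
  \<comment> \<open>Numerator and denominator have the same sign, since the power is increasing or
    decreasing according to the sign of its exponent. This permits adding the two bounds inside
    \<open>ennreal\<close>.\<close>
  have nonneg: "(R powr (b - a) - q powr (b - a)) / (b - a) \<ge> 0"
  proof (cases "a < b")
    case True
    then show ?thesis using q by (auto intro!: divide_nonneg_nonneg powr_mono2)
  next
    case False
    then have "q > 0" using ab q by force
    then show ?thesis using False q by (auto intro!: divide_nonpos_nonpos powr_mono2')
  qed
  have "ennreal (c * R powr (b - a)) + ennreal (a * c * ((R powr (b - a) - q powr (b - a)) / (b - a)))
      = ennreal (c * R powr (b - a) + a * c * ((R powr (b - a) - q powr (b - a)) / (b - a)))"
    using a c nonneg by (intro ennreal_plus[symmetric] mult_nonneg_nonneg) auto
  also have "c * R powr (b - a) + a * c * ((R powr (b - a) - q powr (b - a)) / (b - a))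
      = c * (R powr (b - a) + a * ((R powr (b - a) - q powr (b - a)) / (b - a)))"
    by (simp add: algebra_simps)
  finally show ?thesis
    using order_trans[OF nn_integral_radial_le[OF h a q] add_mono[OF 1 2]] by simp
qed

subsection \<open>Estimates for a fixed time\<close>

text \<open>The setting at one time: \<open>h\<close> is a Borel version of the density,
  \<open>L\<close> bounds its mass and \<open>M\<close> its \<open>Y_ul_norm\<close>. The constants
  \<open>A\<close>, \<open>C0\<close>, \<open>K\<close> and \<open>C1\<close> below do not involve
  \<open>h\<close>, which makes the final estimates uniform in time.\<close>

locale uniform_density =
  fixes h :: "'a::euclidean_space \<Rightarrow> real" and \<Theta> :: "real \<Rightarrow> real" and L M d :: real
  assumes d_eq: "d = real DIM('a)"
    and borel [measurable]: "h \<in> borel_measurable borel"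
    and \<Theta>: "growth_function \<Theta>"
    and L: "L \<ge> 0" and M: "M > 0"
    and L1: "(\<integral>\<^sup>+y. ennreal \<bar>h y\<bar> \<partial>lborel) \<le> ennreal L"
    and Lp: "p \<ge> 1 \<Longrightarrow>
      (\<integral>\<^sup>+y\<in>ball x 1. ennreal (\<bar>h y\<bar> powr p) \<partial>lborel) \<le> ennreal ((M * \<Theta> p) powr p)"
begin

section \<open>Masses of balls and integrals of the density against powers of the distance\<close>

text \<open>The 2 comes from the truncation argument; the maximum dominates
  \<open>unit_ball_vol d powr (1 - 1 / p)\<close> for all \<open>p \<ge> 1\<close> at once.\<close>

definition A :: real where "A = 2 * M * max 1 (unit_ball_vol d)"

lemma d_ge_1: "d \<ge> 1"
  using DIM_positive[where 'a='a] d_eq by linarith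

lemma A_pos: "A > 0"
  using M by (auto simp: A_def less_max_iff_disj)

lemma \<Theta>_pos: "r \<ge> 0 \<Longrightarrow> \<Theta> r > 0"
  using \<Theta> by (simp add: growth_function_def)

lemma \<Theta>_mono: "0 \<le> r \<Longrightarrow> r \<le> s \<Longrightarrow> \<Theta> r \<le> \<Theta> s"
  using \<Theta> by (auto simp: growth_function_def mono_on_def)

lemma mass_ball_le:
  assumes s: "0 < s" "s \<le> 1" and p: "p \<ge> 1"
  shows "(\<integral>\<^sup>+z\<in>ball x s. ennreal \<bar>h z\<bar> \<partial>lborel) \<le> ennreal (A * \<Theta> p * s powr (d - d / p))"
proof -
  define V where "V = unit_ball_vol d * s ^ DIM('a)"
  have V: "V > 0" using s d_ge_1 unit_ball_vol_pos[of d] by (simp add: V_def)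
  have "(\<integral>\<^sup>+z\<in>ball x s. ennreal \<bar>h z\<bar> \<partial>lborel) \<le> ennreal (2 * (M * \<Theta> p) * V powr (1 - 1 / p))"
  proof (rule nn_integral_abs_le_powr)
    have "(\<integral>\<^sup>+z\<in>ball x s. ennreal (\<bar>h z\<bar> powr p) \<partial>lborel)
        \<le> (\<integral>\<^sup>+z\<in>ball x 1. ennreal (\<bar>h z\<bar> powr p) \<partial>lborel)"
      using s by (intro nn_integral_mono) (auto simp: indicator_def)
    then show "(\<integral>\<^sup>+z\<in>ball x s. ennreal (\<bar>h z\<bar> powr p) \<partial>lborel) \<le> ennreal ((M * \<Theta> p) powr p)"
      using Lp[OF p, of x] by (rule order_trans)
  qed (use s p V M \<Theta>_pos[of p] in \<open>auto simp: emeasure_ball V_def d_eq\<close>)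
  also have "V powr (1 - 1 / p) = unit_ball_vol d powr (1 - 1 / p) * s powr (d - d / p)"
    using s d_ge_1 unit_ball_vol_pos[of d]
    by (simp add: V_def d_eq powr_mult powr_powr right_diff_distrib flip: powr_realpow)
  also have "ennreal (2 * (M * \<Theta> p) * (unit_ball_vol d powr (1 - 1 / p) * s powr (d - d / p)))
      \<le> ennreal (2 * (M * \<Theta> p) * (max 1 (unit_ball_vol d) * s powr (d - d / p)))"
  proof (intro ennreal_leI mult_left_mono mult_right_mono)
    have "unit_ball_vol d powr (1 - 1 / p) \<le> max 1 (unit_ball_vol d) powr (1 - 1 / p)"
      using p d_ge_1 unit_ball_vol_pos[of d] by (intro powr_mono2) auto
    also have "\<dots> \<le> max 1 (unit_ball_vol d) powr 1"
      using p by (intro powr_mono) auto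
    finally show "unit_ball_vol d powr (1 - 1 / p) \<le> max 1 (unit_ball_vol d)" by simp
  qed (use M p \<Theta>_pos[of p] in auto)
  finally show ?thesis by (simp add: A_def mult_ac)
qed

text \<open>Radial integration with \<open>a = d - 1\<close> and \<open>b = d - d / p\<close>. Since
  \<open>p \<ge> d + 1\<close>, the exponent \<open>b - a = 1 - d / p\<close> is at least
  \<open>1 / (d + 1)\<close>, so the constant is at most \<open>1 + (d - 1) * (d + 1)\<close>, which
  is the square of \<open>d\<close>, independently of \<open>p\<close>.\<close>

lemma nn_integral_near_le:
  assumes R: "0 < R" "R \<le> 1" and p: "p \<ge> d + 1"
  shows "(\<integral>\<^sup>+z\<in>ball x R. ennreal (\<bar>h z\<bar> * dist x z powr (1 - d)) \<partial>lborel)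
    \<le> ennreal (A * \<Theta> p * d\<^sup>2 * R powr (1 - d / p))"
proof -
  have e: "1 - d / p \<ge> 1 / (d + 1)"
    using d_ge_1 p mult_left_mono[of "d + 1" p d] by (simp add: field_simps)
  then have e0: "1 - d / p > 0" using d_ge_1 by (smt (verit) divide_pos_pos)
  have "(\<integral>\<^sup>+z\<in>ball x R. ennreal (\<bar>h z\<bar> * dist x z powr (1 - d)) \<partial>lborel)
      = (\<integral>\<^sup>+z\<in>{z. 0 \<le> dist x z \<and> dist x z < R}.
          (ennreal \<bar>h z\<bar> * ennreal (dist x z powr - (d - 1))) \<partial>lborel)"
    by (intro nn_integral_cong) (simp add: indicator_def ennreal_mult)
  also have "\<dots> \<le> ennreal (A * \<Theta> p * (R powr (d - d / p - (d - 1)) + (d - 1) *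
      ((R powr (d - d / p - (d - 1)) - 0 powr (d - d / p - (d - 1))) / (d - d / p - (d - 1)))))"
    using R d_ge_1 p A_pos \<Theta>_pos[of p] e0
    by (intro nn_integral_radial_powr_le) (auto intro!: mass_ball_le)
  also have "\<dots> = ennreal (A * \<Theta> p * (1 + (d - 1) / (1 - d / p)) * R powr (1 - d / p))"
    by (simp add: algebra_simps)
  also have "\<dots> \<le> ennreal (A * \<Theta> p * d\<^sup>2 * R powr (1 - d / p))"
  proof (intro ennreal_leI mult_right_mono mult_left_mono)
    have "(d - 1) / (1 - d / p) \<le> (d - 1) / (1 / (d + 1))"
      using d_ge_1 e e0 by (intro divide_left_mono) auto
    then show "1 + (d - 1) / (1 - d / p) \<le> d\<^sup>2" by (simp add: algebra_simps power2_eq_square)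
  qed (use A_pos d_ge_1 p \<Theta>_pos[of p] in auto)
  finally show ?thesis .
qed

text \<open>Now \<open>a = d\<close>, so the exponent \<open>b - a = - d / p\<close> is negative and
  tends to zero for large \<open>p\<close>. Division by it produces the factor \<open>p\<close>,
  which becomes the logarithm in the modulus. The negative remainder \<open>1 - p\<close> is
  dropped.\<close>

lemma nn_integral_mid_le:
  assumes q: "0 < q" "q < 1" and p: "p \<ge> d + 1"
  shows "(\<integral>\<^sup>+z\<in>{z. q \<le> dist x z \<and> dist x z < 1}. ennreal (\<bar>h z\<bar> * dist x z powr (- d)) \<partial>lborel)
    \<le> ennreal (A * \<Theta> p * p * q powr (- d / p))"
proof -
  have dp: "d / p > 0" using d_ge_1 p by simp
  have "(\<integral>\<^sup>+z\<in>{z. q \<le> dist x z \<and> dist x z < 1}. ennreal (\<bar>h z\<bar> * dist x z powr (- d)) \<partial>lborel)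
      = (\<integral>\<^sup>+z\<in>{z. q \<le> dist x z \<and> dist x z < 1}.
          (ennreal \<bar>h z\<bar> * ennreal (dist x z powr - d)) \<partial>lborel)"
    by (intro nn_integral_cong) (simp add: ennreal_mult)
  also have "\<dots> \<le> ennreal (A * \<Theta> p * (1 powr (d - d / p - d) + d *
      ((1 powr (d - d / p - d) - q powr (d - d / p - d)) / (d - d / p - d))))"
    using q d_ge_1 p A_pos \<Theta>_pos[of p] dp
    by (intro nn_integral_radial_powr_le) (auto intro!: mass_ball_le)
  also have "1 powr (d - d / p - d) + d *
      ((1 powr (d - d / p - d) - q powr (d - d / p - d)) / (d - d / p - d)) = 1 - p + p * q powr (- d / p)"
  proof -
    have "d * ((1 - Q) / (- (d / p))) = p * Q - p" for Q
      using d_ge_1 p by (simp add: field_simps)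
    then show ?thesis by simp
  qed
  also have "ennreal (A * \<Theta> p * (1 - p + p * q powr (- d / p)))
      \<le> ennreal (A * \<Theta> p * (p * q powr (- d / p)))"
    using d_ge_1 p A_pos \<Theta>_pos[of p] by (intro ennreal_leI mult_left_mono) auto
  finally show ?thesis by (simp add: mult.assoc)
qed

section \<open>Boundedness of the field\<close>

definition C0 :: real where "C0 = A * \<Theta> (d + 1) * d\<^sup>2 + L"

lemma C0_nonneg: "C0 \<ge> 0"
  using A_pos L d_ge_1 \<Theta>_pos[of "d + 1"] by (simp add: C0_def)

text \<open>Split at distance one: inside, the near estimate with \<open>R = 1\<close> and
  \<open>p = d + 1\<close>; outside, the kernel has norm at most 1 and the total mass
  suffices.\<close>

lemma nn_integral_field_le:
  "(\<integral>\<^sup>+z. ennreal (norm (h z *\<^sub>R kernel (x - z))) \<partial>lborel) \<le> ennreal C0"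
proof -
  have "(\<integral>\<^sup>+z. ennreal (norm (h z *\<^sub>R kernel (x - z))) \<partial>lborel)
      \<le> (\<integral>\<^sup>+z. (ennreal (\<bar>h z\<bar> * dist x z powr (1 - d)) * indicator (ball x 1) z
          + ennreal \<bar>h z\<bar>) \<partial>lborel)"
  proof (intro nn_integral_mono)
    fix z
    have "dist x z powr (1 - d) \<le> 1" if "dist x z \<ge> 1"
      using powr_mono[of "1 - d" 0 "dist x z"] that d_ge_1 by (auto split: if_splits)
    then have "\<bar>h z\<bar> * dist x z powr (1 - d) \<le> \<bar>h z\<bar>" if "dist x z \<ge> 1"
      using that mult_left_le[of "dist x z powr (1 - d)" "\<bar>h z\<bar>"] by simp
    then show "ennreal (norm (h z *\<^sub>R kernel (x - z)))
        \<le> ennreal (\<bar>h z\<bar> * dist x z powr (1 - d)) * indicator (ball x 1) z + ennreal \<bar>h z\<bar>"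
      by (auto simp: norm_kernel d_eq indicator_def dist_norm simp flip: ennreal_plus intro!: ennreal_leI)
  qed
  also have "\<dots> = (\<integral>\<^sup>+z\<in>ball x 1. ennreal (\<bar>h z\<bar> * dist x z powr (1 - d)) \<partial>lborel)
      + (\<integral>\<^sup>+z. ennreal \<bar>h z\<bar> \<partial>lborel)"
    by (intro nn_integral_add) measurable
  also have "\<dots> \<le> ennreal (A * \<Theta> (d + 1) * d\<^sup>2 * 1 powr (1 - d / (d + 1))) + ennreal L"
    by (intro add_mono nn_integral_near_le L1) auto
  also have "\<dots> = ennreal C0"
    using A_pos L d_ge_1 \<Theta>_pos[of "d + 1"] by (simp add: C0_def ennreal_plus)
  finally show ?thesis .
qed

lemma integrable_field: "integrable lborel (\<lambda>z. h z *\<^sub>R kernel (x - z))"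
proof (rule integrableI_bounded)
  show "(\<integral>\<^sup>+z. ennreal (norm (h z *\<^sub>R kernel (x - z))) \<partial>lborel) < \<infinity>"
    using nn_integral_field_le[of x] by (rule order_le_less_trans) simp
qed measurable

definition E :: "'a \<Rightarrow> 'a" where "E x = (\<integral>z. h z *\<^sub>R kernel (x - z) \<partial>lborel)"

lemma norm_E_le: "norm (E x) \<le> C0"
proof -
  have "ennreal (norm (E x)) \<le> ennreal C0"
    unfolding E_def using integral_norm_bound_ennreal[OF integrable_field] nn_integral_field_le
    by (rule order_trans)
  then show ?thesis using C0_nonneg by simp
qed

section \<open>The modulus of continuity of the field\<close>

text \<open>The constant of \<open>norm_kernel_diff_le\<close>, expressed through the real parameter
  \<open>d\<close>.\<close>

definition K :: real where "K = 1 + d * 3 powr (d - 1)"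

lemma K_ge_1: "K \<ge> 1" using d_ge_1 by (simp add: K_def)

lemma K_eq: "K = 1 + real DIM('a) * 3 ^ (DIM('a) - 1)"
  unfolding K_def by (simp add: d_eq of_nat_diff flip: powr_realpow)

text \<open>The four terms are the two near fields, around \<open>x\<close> and around \<open>y\<close>, the middle range and the far range.\<close>

lemma norm_kernel_diff_le_split:
  fixes x y z :: 'a
  defines "r \<equiv> dist x y"
  assumes "r > 0"
  shows "norm (kernel (x - z) - kernel (y - z))
    \<le> dist x z powr (1 - d) * indicator (ball x (2 * r)) z
      + dist y z powr (1 - d) * indicator (ball y (3 * r)) z
      + K * r * (dist x z powr (- d) * indicator {z. 2 * r \<le> dist x z \<and> dist x z < 1} z)
      + K * r"
proof (cases "dist x z < 2 * r")
  case True
  \<comment> \<open>A ball around \<open>y\<close> containing the near region around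
    \<open>x\<close>, so that the second kernel can be integrated around its own
    singularity.\<close>
  then have "dist y z < 3 * r"
    using dist_triangle[of y z x] by (simp add: r_def dist_commute)
  moreover have "norm (kernel (x - z) - kernel (y - z)) \<le> dist x z powr (1 - d) + dist y z powr (1 - d)"
    using norm_triangle_ineq4[of "kernel (x - z)" "kernel (y - z)"] by (simp add: norm_kernel d_eq dist_norm)
  ultimately show ?thesis
    using True K_ge_1 \<open>r > 0\<close> by (auto simp: indicator_def intro!: add_increasing2)
next
  case False
  \<comment> \<open>The condition \<open>2 * r \<le> dist x z\<close> is exactly the comparability
    hypothesis of \<open>norm_kernel_diff_le\<close>.\<close>
  have "norm (kernel (x - z) - kernel (y - z)) \<le> K * r * dist x z powr (- d)"
    using norm_kernel_diff_le[of "x - z" "y - z", folded K_eq, folded d_eq] False \<open>r > 0\<close>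
    by (cases "x = z") (auto simp: r_def dist_norm)
  moreover have "K * r * dist x z powr (- d) \<le> K * r" if "dist x z \<ge> 1"
    using powr_mono[of "- d" 0 "dist x z"] that d_ge_1 K_ge_1 \<open>r > 0\<close>
    by (intro mult_left_le) (auto split: if_splits)
  ultimately have "norm (kernel (x - z) - kernel (y - z))
    \<le> K * r * (dist x z powr (- d) * indicator {z. 2 * r \<le> dist x z \<and> dist x z < 1} z) + K * r"
    using False K_ge_1 \<open>r > 0\<close> by (auto simp: indicator_def intro: order_trans add_increasing2)
  moreover have "0 \<le> dist x z powr (1 - d) * indicator (ball x (2 * r)) z
      + dist y z powr (1 - d) * indicator (ball y (3 * r)) z"
    by (simp add: indicator_def)
  ultimately show ?thesis by linarith
qed

text \<open>The 5 is 2 + 3, from the radii of the near balls; the \<open>K\<close> beside it belongs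
  to the middle range. The second summand covers the far range, and the last one covers distances
  beyond \<open>exp (- d - 1)\<close>, where it divides by the constant value of
  \<open>phi\<close>.\<close>

definition C1 :: real where
  "C1 = A * (5 * d\<^sup>2 + K) * exp d + K * L / \<Theta> 0 + 2 * C0 / (exp (- d - 1) * (d + 1) * \<Theta> (d + 1))"

lemma phi_large: "r \<ge> exp (- d - 1) \<Longrightarrow> phi DIM('a) \<Theta> r = exp (- d - 1) * (d + 1) * \<Theta> (d + 1)"
  using exp_gt_zero[of "- d - 1"] by (auto simp: phi_def d_eq)

lemma phi_small: "0 < r \<Longrightarrow> r < exp (- d - 1) \<Longrightarrow> phi DIM('a) \<Theta> r = r * \<bar>ln r\<bar> * \<Theta> \<bar>ln r\<bar>"
  by (simp add: phi_def d_eq)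

text \<open>Permits division by the modulus. On the small branch
  \<open>r < exp (- d - 1) < 1\<close>, so the logarithm does not vanish.\<close>

lemma phi_pos: "r > 0 \<Longrightarrow> phi DIM('a) \<Theta> r > 0"
proof -
  assume r: "r > 0"
  have "exp (- d - 1) < 1" using d_ge_1 by simp
  then have "ln r \<noteq> 0" if "r < exp (- d - 1)" using that r by (auto simp: ln_eq_zero_iff)
  then show ?thesis using r d_ge_1 \<Theta>_pos phi_small[of r] phi_large[of r]
    by (cases "r < exp (- d - 1)") auto
qed

text \<open>Beyond \<open>exp (- d - 1)\<close> the modulus is constant and boundedness of
  \<open>E\<close> suffices. Below it, \<open>\<bar>ln r\<bar> > d + 1\<close> is an admissible
  exponent in the near and middle estimates.\<close>

lemma norm_E_diff_le:
  assumes "x \<noteq> y"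
  shows "norm (E x - E y) \<le> C1 * phi DIM('a) \<Theta> (norm (x - y))"
proof (cases "dist x y < exp (- d - 1)")
  case False
  have "norm (E x - E y) \<le> 2 * C0"
    using norm_triangle_ineq4[of "E x" "E y"] norm_E_le[of x] norm_E_le[of y] by linarith
  also have "\<dots> = (2 * C0 / (exp (- d - 1) * (d + 1) * \<Theta> (d + 1))) * phi DIM('a) \<Theta> (norm (x - y))"
    using False d_ge_1 \<Theta>_pos[of "d + 1"] by (simp add: phi_large dist_norm)
  also have "\<dots> \<le> C1 * phi DIM('a) \<Theta> (norm (x - y))"
    using assms phi_pos[of "norm (x - y)"] A_pos K_ge_1 L \<Theta>_pos[of 0]
    by (intro mult_right_mono) (auto simp: C1_def)
  finally show ?thesis .
next
  case True
  define r where "r = dist x y"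
  define p where "p = \<bar>ln r\<bar>"
  have r: "0 < r" "r < exp (- d - 1)" using assms True by (auto simp: r_def)
  have "ln r < - d - 1" using r by (metis exp_less_cancel_iff exp_ln)
  then have p: "p > d + 1" "ln r = - p" using d_ge_1 by (auto simp: p_def)
  \<comment> \<open>As \<open>d \<ge> 1\<close>, the threshold is below 1/3, so the radii
    \<open>2 * r\<close> and \<open>3 * r\<close> are both less than 1.\<close>
  have "exp (- d - 1) \<le> exp (- 2 :: real)" using d_ge_1 by simp
  also have "\<dots> \<le> 1 / 3"
    using exp_ge_add_one_self[of 2] by (simp add: exp_minus field_simps)
  finally have r3: "3 * r < 1" using r by simp
  have phi: "phi DIM('a) \<Theta> r = r * p * \<Theta> p" using r by (simp add: phi_small p_def)
  have \<Theta>p: "\<Theta> p > 0" using \<Theta>_pos p d_ge_1 by simp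
  \<comment> \<open>The effect of the choice of \<open>p\<close>: since \<open>ln r = - p\<close>,
    the loss in the exponent is a constant.\<close>
  have rp: "r powr (- d / p) = exp d" using r p d_ge_1 by (simp add: powr_def)
  have rp1: "(c * r) powr (1 - d / p) \<le> c * r * exp d" if "c \<ge> 1" for c
  proof -
    have "(c * r) powr (1 - d / p) = c powr (1 - d / p) * (r * r powr (- d / p))"
      using r that by (simp add: powr_mult powr_diff powr_minus_divide)
    also have "\<dots> \<le> c powr 1 * (r * r powr (- d / p))"
      using that r d_ge_1 p by (intro mult_right_mono powr_mono) auto
    finally show ?thesis using that rp by simp
  qed
  have rp2: "(2 * r) powr (- d / p) \<le> exp d"
    using r d_ge_1 p unfolding rp[symmetric] by (intro powr_mono2') auto
  let ?n1 = "\<lambda>z. ennreal (\<bar>h z\<bar> * dist x z powr (1 - d)) * indicator (ball x (2 * r)) z"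
  let ?n2 = "\<lambda>z. ennreal (\<bar>h z\<bar> * dist y z powr (1 - d)) * indicator (ball y (3 * r)) z"
  let ?m = "\<lambda>z. ennreal (\<bar>h z\<bar> * dist x z powr (- d)) * indicator {z. 2 * r \<le> dist x z \<and> dist x z < 1} z"
  have "E x - E y = (\<integral>z. h z *\<^sub>R (kernel (x - z) - kernel (y - z)) \<partial>lborel)"
    unfolding E_def scaleR_diff_right by (intro Bochner_Integration.integral_diff[symmetric] integrable_field)
  then have "ennreal (norm (E x - E y))
      \<le> (\<integral>\<^sup>+z. ennreal (norm (h z *\<^sub>R (kernel (x - z) - kernel (y - z)))) \<partial>lborel)"
    using integral_norm_bound_ennreal[OF Bochner_Integration.integrable_diff[OF integrable_field[of x] integrable_field[of y]]]
    by (simp add: scaleR_diff_right)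
  also have "\<dots> \<le> (\<integral>\<^sup>+z. (?n1 z + ?n2 z + ennreal (K * r) * ?m z + ennreal (K * r) * ennreal \<bar>h z\<bar>) \<partial>lborel)"
  proof (intro nn_integral_mono)
    fix z
    have "norm (h z *\<^sub>R (kernel (x - z) - kernel (y - z)))
        \<le> \<bar>h z\<bar> * (dist x z powr (1 - d) * indicator (ball x (2 * r)) z
      + dist y z powr (1 - d) * indicator (ball y (3 * r)) z
      + K * r * (dist x z powr (- d) * indicator {z. 2 * r \<le> dist x z \<and> dist x z < 1} z)
      + K * r)"
      using norm_kernel_diff_le_split[of x y z] r by (auto simp: r_def intro!: mult_left_mono)
    then show "ennreal (norm (h z *\<^sub>R (kernel (x - z) - kernel (y - z))))
        \<le> ?n1 z + ?n2 z + ennreal (K * r) * ?m z + ennreal (K * r) * ennreal \<bar>h z\<bar>"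
      using r K_ge_1
      by (auto simp: indicator_def algebra_simps simp flip: ennreal_plus ennreal_mult intro!: ennreal_leI)
  qed
  also have "\<dots> = (\<integral>\<^sup>+z. ?n1 z \<partial>lborel) + (\<integral>\<^sup>+z. ?n2 z \<partial>lborel)
      + ennreal (K * r) * (\<integral>\<^sup>+z. ?m z \<partial>lborel) + ennreal (K * r) * (\<integral>\<^sup>+z. ennreal \<bar>h z\<bar> \<partial>lborel)"
    by (simp add: nn_integral_add nn_integral_cmult)
  also have "\<dots> \<le> ennreal (A * \<Theta> p * d\<^sup>2 * (2 * r) powr (1 - d / p))
      + ennreal (A * \<Theta> p * d\<^sup>2 * (3 * r) powr (1 - d / p))
      + ennreal (K * r) * ennreal (A * \<Theta> p * p * (2 * r) powr (- d / p)) + ennreal (K * r) * ennreal L"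
    using r r3 p by (intro add_mono mult_left_mono nn_integral_near_le nn_integral_mid_le L1) auto
  also have "\<dots> \<le> ennreal (A * \<Theta> p * d\<^sup>2 * (2 * r * exp d))
      + ennreal (A * \<Theta> p * d\<^sup>2 * (3 * r * exp d))
      + ennreal (K * r) * ennreal (A * \<Theta> p * p * exp d) + ennreal (K * r) * ennreal L"
    using A_pos \<Theta>p d_ge_1 p
    by (intro add_mono mult_left_mono ennreal_leI rp1 rp2) auto
  also have "\<dots> = ennreal (A * \<Theta> p * d\<^sup>2 * (2 * r * exp d) + A * \<Theta> p * d\<^sup>2 * (3 * r * exp d)
      + K * r * (A * \<Theta> p * p * exp d) + K * r * L)"
    using A_pos \<Theta>p d_ge_1 p K_ge_1 r L by (simp flip: ennreal_plus ennreal_mult)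
  finally have "norm (E x - E y) \<le> A * \<Theta> p * d\<^sup>2 * (2 * r * exp d) + A * \<Theta> p * d\<^sup>2 * (3 * r * exp d)
      + K * r * (A * \<Theta> p * p * exp d) + K * r * L"
    using A_pos \<Theta>p d_ge_1 p K_ge_1 r L by (subst (asm) ennreal_le_iff) auto
  \<comment> \<open>Each term is put in the form of a constant times \<open>r\<close>, a factor at
    most \<open>p\<close> and a value of \<open>\<Theta>\<close> at most \<open>\<Theta> p\<close>,
    so that monotonicity brings all of them to \<open>r * p * \<Theta> p\<close>.\<close>
  also have "\<dots> = (5 * A * d\<^sup>2 * exp d) * (r * 1 * \<Theta> p) + (K * A * exp d) * (r * p * \<Theta> p)
      + (K * L / \<Theta> 0) * (r * 1 * \<Theta> 0)"
    using \<Theta>_pos[of 0] by (simp add: algebra_simps)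
  also have "\<dots> \<le> (5 * A * d\<^sup>2 * exp d) * (r * p * \<Theta> p) + (K * A * exp d) * (r * p * \<Theta> p)
      + (K * L / \<Theta> 0) * (r * p * \<Theta> p)"
    using A_pos K_ge_1 L r p d_ge_1 \<Theta>p \<Theta>_pos[of 0] \<Theta>_mono[of 0 p] by (intro add_mono mult_left_mono mult_mono) auto
  also have "\<dots> = (C1 - 2 * C0 / (exp (- d - 1) * (d + 1) * \<Theta> (d + 1))) * phi DIM('a) \<Theta> r"
    by (simp add: C1_def phi algebra_simps)
  also have "\<dots> \<le> C1 * phi DIM('a) \<Theta> r"
    using C0_nonneg d_ge_1 \<Theta>_pos[of "d + 1"] phi_pos[of r] r by (intro mult_right_mono) auto
  finally show ?thesis by (simp add: r_def dist_norm)
qed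

end

section \<open>Integral bounds from the norms of the density and of \<open>f\<close>\<close>

text \<open>Unpacks the nested suprema at one \<open>p\<close> and one ball, then undoes the
  \<open>p\<close>-th root.\<close>

lemma nn_integral_ball_le_Y_ul_norm:
  assumes \<Theta>: "growth_function \<Theta>" and Y: "Y_ul_norm \<Theta> g \<le> ennreal M" and M: "M > 0" and p: "p \<ge> 1"
  shows "(\<integral>\<^sup>+y\<in>ball x 1. ennreal (\<bar>g y\<bar> powr p) \<partial>lebesgue) \<le> ennreal ((M * \<Theta> p) powr p)"
proof -
  have \<Theta>p: "\<Theta> p > 0" using \<Theta> p by (simp add: growth_function_def)
  define I where "I = (\<integral>\<^sup>+y\<in>ball x 1. ennreal (\<bar>g y\<bar> powr p) \<partial>lebesgue)"
  have "Lp_norm_on (ball x 1) p g / ennreal (\<Theta> p) \<le> Lp_ul_norm p g / ennreal (\<Theta> p)"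
    unfolding Lp_ul_norm_def by (intro divide_right_mono_ennreal SUP_upper) simp
  also have "\<dots> \<le> Y_ul_norm \<Theta> g"
    unfolding Y_ul_norm_def using p by (intro SUP_upper) simp
  also note Y
  finally have "Lp_norm_on (ball x 1) p g / ennreal (\<Theta> p) * ennreal (\<Theta> p) \<le> ennreal M * ennreal (\<Theta> p)"
    by (rule mult_right_mono) simp
  then have *: "Lp_norm_on (ball x 1) p g \<le> ennreal (M * \<Theta> p)"
    using M \<Theta>p by (simp add: ennreal_mult ennreal_divide_times)
  \<comment> \<open>\<open>Lp_norm_on\<close> is infinite whenever the integral is, so the finite
    bound excludes this case; only then is \<open>enn2real\<close> faithful.\<close>
  then have "I \<noteq> \<infinity>"
    unfolding Lp_norm_on_def I_def[symmetric] by (auto simp: Let_def top_unique split: if_splits)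
  then obtain i where i: "I = ennreal i" "i \<ge> 0" by (cases I) auto
  then have "i powr (1 / p) \<le> M * \<Theta> p"
    using * M \<Theta>p unfolding Lp_norm_on_def I_def[symmetric] by (simp add: Let_def)
  then have "(i powr (1 / p)) powr p \<le> (M * \<Theta> p) powr p"
    using p by (intro powr_mono2) auto
  then have "i \<le> (M * \<Theta> p) powr p"
    using p i by (simp add: powr_powr)
  then show ?thesis using i unfolding I_def by (simp add: ennreal_leI)
qed

text \<open>Bounds the mass of the density by that of \<open>f\<close>. Tonelli's theorem is applied
  to a Borel version of \<open>f\<close>, which agrees with \<open>f\<close> almost everywhere on
  almost every slice.\<close>

lemma nn_integral_marginal_le:
  fixes f :: "'b::euclidean_space \<times> 'c::euclidean_space \<Rightarrow> real"
  assumes "f \<in> borel_measurable lebesgue"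
  shows "(\<integral>\<^sup>+x. ennreal \<bar>\<integral>v. f (x, v) \<partial>lebesgue\<bar> \<partial>lebesgue) \<le> (\<integral>\<^sup>+z. ennreal \<bar>f z\<bar> \<partial>lebesgue)"
proof -
  obtain g where g [measurable]: "g \<in> borel_measurable lborel" and fg: "AE z in lborel. f z = g z"
    using completion_ex_borel_measurable_real[OF assms] by blast
  have gm: "(\<lambda>(x, v). ennreal \<bar>g (x, v)\<bar>) \<in> borel_measurable (lborel \<Otimes>\<^sub>M lborel)"
    using g by (simp add: lborel_prod case_prod_unfold)
  have AE: "AE x in lborel. AE v in lborel. f (x, v) = g (x, v)"
    using fg unfolding lborel_prod[symmetric] by (rule lborel_pair.AE_pair)
  have "(\<integral>\<^sup>+x. ennreal \<bar>\<integral>v. f (x, v) \<partial>lebesgue\<bar> \<partial>lebesgue)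
      = (\<integral>\<^sup>+x. ennreal \<bar>\<integral>v. f (x, v) \<partial>lebesgue\<bar> \<partial>lborel)"
    by (rule nn_integral_completion)
  also have "\<dots> \<le> (\<integral>\<^sup>+x. (\<integral>\<^sup>+v. ennreal \<bar>g (x, v)\<bar> \<partial>lborel) \<partial>lborel)"
  proof (rule nn_integral_mono_AE, use AE in eventually_elim)
    fix x assume x: "AE v in lborel. f (x, v) = g (x, v)"
    have "ennreal \<bar>\<integral>v. f (x, v) \<partial>lebesgue\<bar> \<le> (\<integral>\<^sup>+v. ennreal \<bar>f (x, v)\<bar> \<partial>lebesgue)"
    \<comment> \<open>A slice that is not integrable has integral 0 by convention, so the bound
      persists.\<close>
    proof (cases "integrable lebesgue (\<lambda>v. f (x, v))")
      case True
      then show ?thesis using integral_norm_bound_ennreal[OF True] by simp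
    qed (simp add: not_integrable_integral_eq)
    also have "\<dots> = (\<integral>\<^sup>+v. ennreal \<bar>f (x, v)\<bar> \<partial>lborel)"
      by (rule nn_integral_completion)
    also have "\<dots> = (\<integral>\<^sup>+v. ennreal \<bar>g (x, v)\<bar> \<partial>lborel)"
      using x by (intro nn_integral_cong_AE) (auto elim: eventually_mono)
    finally show "ennreal \<bar>\<integral>v. f (x, v) \<partial>lebesgue\<bar> \<le> (\<integral>\<^sup>+v. ennreal \<bar>g (x, v)\<bar> \<partial>lborel)" .
  qed
  also have "\<dots> = (\<integral>\<^sup>+z. ennreal \<bar>g z\<bar> \<partial>(lborel \<Otimes>\<^sub>M lborel))"
    using lborel.nn_integral_fst[OF gm] by (simp add: case_prod_unfold)
  also have "\<dots> = (\<integral>\<^sup>+z. ennreal \<bar>g z\<bar> \<partial>lborel)" by (simp add: lborel_prod)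
  also have "\<dots> = (\<integral>\<^sup>+z. ennreal \<bar>f z\<bar> \<partial>lborel)"
    using fg by (intro nn_integral_cong_AE) (auto elim: eventually_mono)
  also have "\<dots> = (\<integral>\<^sup>+z. ennreal \<bar>f z\<bar> \<partial>lebesgue)"
    by (rule nn_integral_completion[symmetric])
  finally show ?thesis .
qed

section \<open>The field as an element of \<open>Cb\<close>\<close>

context uniform_density
begin

lemma borel_measurable_E [measurable]: "E \<in> borel_measurable borel"
proof -
  have "(\<lambda>x. \<integral>z. h z *\<^sub>R kernel (x - z) \<partial>lborel) \<in> borel_measurable borel"
    by measurable
  then show ?thesis by (simp add: E_def[abs_def])
qed

lemma C1_nonneg: "C1 \<ge> 0"
  using C0_nonneg A_pos K_ge_1 L d_ge_1 \<Theta>_pos[of 0] \<Theta>_pos[of "d + 1"] by (simp add: C1_def)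

lemma scaled_E_in_Cb:
  assumes "\<kappa> \<in> {-1, 1}"
  shows "(\<lambda>x. \<kappa> *\<^sub>R E x) \<in> Cb (phi DIM('a) \<Theta>)"
    and "Cb_norm (phi DIM('a) \<Theta>) (\<lambda>x. \<kappa> *\<^sub>R E x) \<le> ennreal (C0 + C1)"
proof -
  have \<kappa>: "\<bar>\<kappa>\<bar> = 1" using assms by auto
  have m: "(\<lambda>x. \<kappa> *\<^sub>R E x) \<in> borel_measurable borel" by measurable
  have 1: "Linf_norm (\<lambda>x. \<kappa> *\<^sub>R E x) \<le> ennreal C0"
    unfolding Linf_norm_def
  proof (rule esssup_I)
    show "(\<lambda>x. ennreal (norm (\<kappa> *\<^sub>R E x))) \<in> borel_measurable lebesgue"
      by (rule measurable_completion) simp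
  qed (use \<kappa> norm_E_le in \<open>auto intro: ennreal_leI\<close>)
  have 2: "modulus_seminorm (phi DIM('a) \<Theta>) (\<lambda>x. \<kappa> *\<^sub>R E x) \<le> ennreal C1"
    unfolding modulus_seminorm_def
  proof (rule SUP_least, clarify)
    fix x y :: 'a assume "x \<noteq> y"
    have "norm (\<kappa> *\<^sub>R E x - \<kappa> *\<^sub>R E y) = norm (E x - E y)"
      using \<kappa> by (simp flip: scaleR_diff_right)
    also have "\<dots> \<le> C1 * phi DIM('a) \<Theta> (norm (x - y))"
      using \<open>x \<noteq> y\<close> by (rule norm_E_diff_le)
    finally show "ennreal (norm (\<kappa> *\<^sub>R E x - \<kappa> *\<^sub>R E y) / phi DIM('a) \<Theta> (norm (x - y))) \<le> ennreal C1"
      using phi_pos[of "norm (x - y)"] \<open>x \<noteq> y\<close> by (intro ennreal_leI) (simp add: divide_le_eq)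
  qed
  show "Cb_norm (phi DIM('a) \<Theta>) (\<lambda>x. \<kappa> *\<^sub>R E x) \<le> ennreal (C0 + C1)"
    using add_mono[OF 1 2] C0_nonneg C1_nonneg by (simp add: Cb_norm_def ennreal_plus)
  show "(\<lambda>x. \<kappa> *\<^sub>R E x) \<in> Cb (phi DIM('a) \<Theta>)"
    using m order_le_less_trans[OF 1 ennreal_less_top] order_le_less_trans[OF 2 ennreal_less_top]
    by (auto simp: Cb_def intro: measurable_completion)
qed

end

section \<open>Passage from Lebesgue measurable densities to Borel versions\<close>

text \<open>The exceptional null set of \<open>y\<close> does not depend on \<open>x\<close>, so the
  replacement is valid at every point \<open>x\<close>, not merely at almost every one.\<close>

lemma integral_kernel_AE_cong:
  fixes u h :: "'a::euclidean_space \<Rightarrow> real"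
  assumes u: "u \<in> borel_measurable lebesgue" and h: "h \<in> borel_measurable borel"
    and AE: "AE y in lborel. u y = h y"
  shows "integrable lebesgue (\<lambda>y. u y *\<^sub>R kernel (x - y)) \<longleftrightarrow> integrable lborel (\<lambda>y. h y *\<^sub>R kernel (x - y))"
    and "(\<integral>y. u y *\<^sub>R kernel (x - y) \<partial>lebesgue) = (\<integral>y. h y *\<^sub>R kernel (x - y) \<partial>lborel)"
proof -
  have hm: "(\<lambda>y. h y *\<^sub>R kernel (x - y)) \<in> borel_measurable lborel"
    using h by measurable
  have km: "(\<lambda>y. kernel (x - y)) \<in> borel_measurable lebesgue"
    by (rule measurable_completion) measurable
  have um: "(\<lambda>y. u y *\<^sub>R kernel (x - y)) \<in> borel_measurable lebesgue"
    using u km by (rule borel_measurable_scaleR)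
  have AE': "AE y in lebesgue. u y *\<^sub>R kernel (x - y) = h y *\<^sub>R kernel (x - y)"
    unfolding AE_completion_iff using AE by eventually_elim simp
  show "integrable lebesgue (\<lambda>y. u y *\<^sub>R kernel (x - y)) \<longleftrightarrow> integrable lborel (\<lambda>y. h y *\<^sub>R kernel (x - y))"
    using integrable_cong_AE[OF um measurable_completion[OF hm] AE'] integrable_completion[OF hm] by simp
  show "(\<integral>y. u y *\<^sub>R kernel (x - y) \<partial>lebesgue) = (\<integral>y. h y *\<^sub>R kernel (x - y) \<partial>lborel)"
    using integral_cong_AE[OF um measurable_completion[OF hm] AE'] integral_completion[OF hm] by simp
qed

text \<open>Transfers the estimates of the locale to a Lebesgue measurable density. The bound
  depends on \<open>u\<close> only through \<open>L\<close> and \<open>M\<close>, so one constant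
  serves almost all times.\<close>

lemma kernel_field_in_Cb:
  fixes u :: "'a::euclidean_space \<Rightarrow> real" and \<Theta> :: "real \<Rightarrow> real" and L M \<kappa> :: real
  defines "E \<equiv> \<lambda>x. \<kappa> *\<^sub>R (\<integral>y. u y *\<^sub>R kernel (x - y) \<partial>lebesgue)"
  assumes \<Theta>: "growth_function \<Theta>" and L: "L \<ge> 0" and M: "M > 0" and \<kappa>: "\<kappa> \<in> {-1, 1}"
    and u: "u \<in> borel_measurable lebesgue"
    and L1: "L1_norm u \<le> ennreal L" and Y: "Y_ul_norm \<Theta> u \<le> ennreal M"
  shows "integrable lebesgue (\<lambda>y. u y *\<^sub>R kernel (x - y))"
    and "E \<in> Cb (phi DIM('a) \<Theta>)"
    and "Cb_norm (phi DIM('a) \<Theta>) E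
      \<le> ennreal (uniform_density.C0 \<Theta> L M DIM('a) + uniform_density.C1 \<Theta> L M DIM('a))"
proof -
  obtain h where h: "h \<in> borel_measurable borel" and uh: "AE y in lborel. u y = h y"
    using completion_ex_borel_measurable_real[OF u] by auto
  have cong: "(\<integral>\<^sup>+y. F y (h y) \<partial>lborel) = (\<integral>\<^sup>+y. F y (u y) \<partial>lebesgue)" for F :: "'a \<Rightarrow> real \<Rightarrow> ennreal"
    unfolding nn_integral_completion using uh
    by (intro nn_integral_cong_AE) (auto elim: eventually_mono)
  interpret uniform_density h \<Theta> L M "real DIM('a)"
  proof
    show "(\<integral>\<^sup>+y. ennreal \<bar>h y\<bar> \<partial>lborel) \<le> ennreal L"
      using L1 cong[of "\<lambda>_ s. ennreal \<bar>s\<bar>"] by (simp add: L1_norm_def)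
    show "(\<integral>\<^sup>+y\<in>ball x 1. ennreal (\<bar>h y\<bar> powr p) \<partial>lborel) \<le> ennreal ((M * \<Theta> p) powr p)" if "p \<ge> 1" for p x
      using nn_integral_ball_le_Y_ul_norm[OF \<Theta> Y M that, of x]
        cong[of "\<lambda>y s. ennreal (\<bar>s\<bar> powr p) * indicator (ball x 1) y"] by simp
  qed (use h \<Theta> L M in auto)
  show "integrable lebesgue (\<lambda>y. u y *\<^sub>R kernel (x - y))"
    using integral_kernel_AE_cong(1)[OF u h uh] integrable_field by simp
  have eq: "E = (\<lambda>x. \<kappa> *\<^sub>R uniform_density.E h x)"
    unfolding assms(1) E_def integral_kernel_AE_cong(2)[OF u h uh] ..
  show "E \<in> Cb (phi DIM('a) \<Theta>)"
    unfolding eq using \<kappa> by (rule scaled_E_in_Cb)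
  show "Cb_norm (phi DIM('a) \<Theta>) E \<le> ennreal (C0 + C1)"
    unfolding eq using \<kappa> by (rule scaled_E_in_Cb)
qed

subsection \<open>Time dependence and joint measurability\<close>

text \<open>A null set times the whole space is null, as \<open>0 * \<infinity> = 0\<close> for
  measures.\<close>

lemma AE_lborel_fst:
  assumes "AE t in lborel. P t"
  shows "AE z in (lborel :: ('b::euclidean_space \<times> 'c::euclidean_space) measure). P (fst z)"
proof -
  obtain N where N: "{t. \<not> P t} \<subseteq> N" "N \<in> null_sets (lborel :: 'b measure)"
    using AE_E[OF assms] by (auto simp: null_sets_def)
  have "emeasure (lborel \<Otimes>\<^sub>M (lborel :: 'c measure)) (N \<times> UNIV) = 0"
    using N by (subst lborel.emeasure_pair_measure_Times) auto
  then have "N \<times> UNIV \<in> null_sets (lborel :: ('b \<times> 'c) measure)"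
    using N by (auto simp: null_sets_def simp flip: lborel_prod)
  then show ?thesis by (rule AE_I') (use N in auto)
qed

text \<open>The fixed-time estimates give convergence and the uniform bound for almost every time.
  Joint measurability is shown separately, by comparing the field with a parameter integral of a
  Borel function.\<close>

theorem lemma1p1:
  fixes T \<kappa> :: real
    and \<Theta> :: "real \<Rightarrow> real"
    and f :: "real \<Rightarrow> 'a::euclidean_space \<times> 'a \<Rightarrow> real"
  assumes "T > 0"
    and "\<kappa> \<in> {-1, 1}"
    and "growth_function \<Theta>"
    and "f \<in> A_space \<Theta> T"
  shows "field_well_defined T f \<and>
    field_of \<kappa> f \<in> Linf_time T (Cb (phi DIM('a) \<Theta>)) (Cb_norm (phi DIM('a) \<Theta>))"
proof -
  define S where "S = {0..T} \<times> (UNIV :: 'a set)"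
  define u where "u = density_of f"
  have S: "S \<in> sets lebesgue" by (simp add: S_def borel_closed closed_Times)
  have T: "{0..T} \<in> sets lebesgue" by simp
  obtain c1 c2 where
    f: "AE t in lebesgue_on {0..T}. f t \<in> L1" "AE t in lebesgue_on {0..T}. L1_norm (f t) \<le> ennreal c1"
    and um: "(\<lambda>(t, x). u t x) \<in> borel_measurable (lebesgue_on S)"
    and u: "AE t in lebesgue_on {0..T}. u t \<in> Y_ul \<Theta>"
      "AE t in lebesgue_on {0..T}. Y_ul_norm \<Theta> (u t) \<le> ennreal c2"
    using assms(4) unfolding A_space_def Linf_time_def u_def S_def by blast
  \<comment> \<open>The essential bounds \<open>c1\<close> and \<open>c2\<close> are arbitrary
    reals; enlarging them secures \<open>L \<ge> 0\<close> and \<open>M > 0\<close>.\<close>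
  define L M where "L = max 0 c1" and "M = max 1 c2"
  define C where "C = uniform_density.C0 \<Theta> L M DIM('a) + uniform_density.C1 \<Theta> L M DIM('a)"
  have good: "AE t in lebesgue_on {0..T}. u t \<in> borel_measurable lebesgue
      \<and> (\<forall>x. integrable lebesgue (field_integrand f t x))
      \<and> field_of \<kappa> f t \<in> Cb (phi DIM('a) \<Theta>)
      \<and> Cb_norm (phi DIM('a) \<Theta>) (field_of \<kappa> f t) \<le> ennreal C"
    using f u
  proof eventually_elim
    case (elim t)
    then have ft: "f t \<in> borel_measurable lebesgue" by (auto simp: L1_def)
    have ut: "u t \<in> borel_measurable lebesgue" using elim by (simp add: Y_ul_def)
    have "L1_norm (u t) \<le> L1_norm (f t)"
      using nn_integral_marginal_le[OF ft] by (simp add: L1_norm_def u_def density_of_def)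
    also have "\<dots> \<le> ennreal L"
      using elim(2) ennreal_leI[of c1 L] unfolding L_def by (meson max.cobounded2 order_trans)
    finally have L: "L1_norm (u t) \<le> ennreal L" .
    have M: "Y_ul_norm \<Theta> (u t) \<le> ennreal M"
      using elim(4) ennreal_leI[of c2 M] unfolding M_def by (meson max.cobounded2 order_trans)
    have L0: "L \<ge> 0" "M > 0" by (auto simp: L_def M_def)
    note * = kernel_field_in_Cb[OF assms(3) L0 assms(2) ut L M]
    show ?case
      using ut * unfolding C_def field_of_def[abs_def] field_integrand_def[abs_def] u_def by blast
  qed
  have good_lborel: "AE t in lborel. t \<in> {0..T} \<longrightarrow> u t \<in> borel_measurable lebesgue"
    using good T by (auto simp: AE_restrict_space_iff AE_completion_iff elim: eventually_mono)

  \<comment> \<open>Extension by zero outside \<open>S\<close> gives a function on all of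
    space-time, which has a Borel version \<open>g\<close>.\<close>
  have "(\<lambda>z. if z \<in> S then (case z of (t, x) \<Rightarrow> u t x) else 0) \<in> borel_measurable lebesgue"
    using um S by (rule borel_measurable_if_I)
  then obtain g where g: "g \<in> borel_measurable (lborel :: (real \<times> 'a) measure)"
    and "AE z in lborel. (if z \<in> S then (case z of (t, x) \<Rightarrow> u t x) else 0) = g z"
    using completion_ex_borel_measurable_real by blast
  then have "AE t in lborel. AE x in lborel.
      (if (t, x) \<in> S then (case (t, x) of (t, x) \<Rightarrow> u t x) else 0) = g (t, x)"
    unfolding lborel_prod[symmetric] by (intro lborel_pair.AE_pair)
  \<comment> \<open>For almost every time the slices of \<open>u\<close> and \<open>g\<close> agree
    almost everywhere, hence their fields agree at every \<open>x\<close>.\<close>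
  with good_lborel have eq: "AE t in lborel. t \<in> {0..T} \<longrightarrow>
      (\<forall>x. field_of \<kappa> f t x = \<kappa> *\<^sub>R (\<integral>y. g (t, y) *\<^sub>R kernel (x - y) \<partial>lborel))"
  proof eventually_elim
    case (elim t)
    show ?case
    proof (intro impI allI)
      fix x assume t: "t \<in> {0..T}"
      have "(\<lambda>y. g (t, y)) \<in> borel_measurable borel" using g by measurable
      then have "(\<integral>y. u t y *\<^sub>R kernel (x - y) \<partial>lebesgue) = (\<integral>y. g (t, y) *\<^sub>R kernel (x - y) \<partial>lborel)"
        using elim t by (intro integral_kernel_AE_cong(2)) (simp_all add: S_def)
      then show "field_of \<kappa> f t x = \<kappa> *\<^sub>R (\<integral>y. g (t, y) *\<^sub>R kernel (x - y) \<partial>lborel)"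
        by (simp add: field_of_def field_integrand_def u_def)
    qed
  qed
  \<comment> \<open>The field of the Borel version, measurable as an integral depending on the
    parameters \<open>t\<close> and \<open>x\<close>.\<close>
  define G where "G = (\<lambda>(t, x). \<kappa> *\<^sub>R (\<integral>y. g (t, y) *\<^sub>R kernel (x - y) \<partial>lborel))"
  have "(\<lambda>(z, y). g (fst z, y) *\<^sub>R kernel (snd z - y))
      \<in> borel_measurable ((borel :: (real \<times> 'a) measure) \<Otimes>\<^sub>M lborel)"
    using g by (simp add: borel_prod[symmetric])
  then have "G \<in> borel_measurable borel"
    unfolding G_def case_prod_unfold
    by (intro borel_measurable_scaleR borel_measurable_const lborel.borel_measurable_lebesgue_integral)
      (simp add: case_prod_unfold)
  then have "G \<in> borel_measurable (lebesgue_on S)"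
    by (intro measurable_restrict_space1 measurable_completion) simp
  then have "(\<lambda>z. if z \<in> S then G z else 0) \<in> borel_measurable lebesgue"
    using S by (rule borel_measurable_if_I)
  \<comment> \<open>Completeness of Lebesgue measure then carries measurability from
    \<open>G\<close> over to the field.\<close>
  moreover have "AE z in lebesgue. (if z \<in> S then G z else 0)
      = (if z \<in> S then (case z of (t, x) \<Rightarrow> field_of \<kappa> f t x) else 0)"
    unfolding AE_completion_iff
    using AE_lborel_fst[OF eq] by eventually_elim (auto simp: S_def G_def)
  ultimately have "(\<lambda>z. if z \<in> S then (case z of (t, x) \<Rightarrow> field_of \<kappa> f t x) else 0)
      \<in> borel_measurable lebesgue"
    by (rule borel_measurable_AE)
  then have "(\<lambda>(t, x). field_of \<kappa> f t x) \<in> borel_measurable (lebesgue_on S)"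
    by (rule borel_measurable_if_D)
  moreover have "AE t in lebesgue_on {0..T}. field_of \<kappa> f t \<in> Cb (phi DIM('a) \<Theta>)"
    "AE t in lebesgue_on {0..T}. Cb_norm (phi DIM('a) \<Theta>) (field_of \<kappa> f t) \<le> ennreal C"
    "AE t in lebesgue_on {0..T}. \<forall>x. integrable lebesgue (field_integrand f t x)"
    using good by (auto elim: eventually_mono)
  ultimately show ?thesis
    unfolding field_well_defined_def Linf_time_def S_def by blast
qed

end
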